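(* Let $p$ be a prime number and $\mathbb{K}$ a field of characteristic $p$. Let $q\ge p+1$ be an integer not divisible by $p$, and let $\ell$ be the smallest nonnegative integer such that $\ell=q$ in $\mathbb{K}$. Let $j\in\{1,2,\dots,\lceil q/p\rceil-1\}$ and put $\ell_j:=\ell+(j-1)p$. Then for every power series $f\in\mathbb{K}[[z]]$ with $f(0)=0$ and $\operatorname{mult}(f)=q+1$, and every integer $n\geq 1$, one has $$i_n(f)=\ell_j(1+p+\dots+p^{n-1})+qp^n$$ if and only if $j$ is the smallest integer such that $\iota_j(f)\neq 0$.
   Context: For a power series $f\in\mathbb{K}[[z]]$ with $f(0)=0$, the multiplicity $\operatorname{mult}(f)$ is the integer $m$ with $f(z)-z=a_mz^m+\cdots$, $a_m\neq0$ (and $\operatorname{mult}(z)=\infty$). The lower ramification numbers of $f$ (with $f(0)=0$, $f'(0)=1$) are $i_n(f)=\operatorname{mult}(f^{p^n})-1$ for $n\ge0$, where $f^{p^n}$ is the $p^n$-th iterate under composition. The integers $\ell_i=\ell+(i-1)p$, $1\le i\le\lceil q/p\rceil$, are exactly the elements of $\{0,\dots,q\}$ congruent to $q$ modulo $p$. For each such $i$, $\iota_i(f)$ denotes the coefficient of $\frac1z$ in the Laurent series expansion about $0$ of $\dfrac{z^{q-\ell_i}}{z-f(z)}$. *)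

theory Defs
  imports
    Complex_Main
    "HOL-Computational_Algebra.Computational_Algebra"
    "HOL-Library.Extended_Nat"
begin

text \<open>
  The multiplicity of a power series \<open>f\<close> with \<open>f(0) = 0\<close> as a fixed point at the origin, i.e. the
  order of vanishing of \<open>f(z) - z\<close>.  Since \<^const>\<open>subdegree\<close> sends the zero series to \<open>0\<close>, the
  case \<open>f(z) = z\<close> has to be separated.
\<close>
definition fixpoint_mult :: "'a::field fps \<Rightarrow> enat" where
  "fixpoint_mult f = (if f = fps_X then \<infinity> else enat (subdegree (f - fps_X)))"

definition fps_iterate :: "'a::field fps \<Rightarrow> nat \<Rightarrow> 'a fps" where
  "fps_iterate f k = (fps_compose f ^^ k) fps_X"

text \<open>Subtraction on \<^typ>\<open>enat\<close> satisfies \<open>\<infinity> - 1 = \<infinity>\<close>.\<close>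
definition lower_ramification :: "nat \<Rightarrow> 'a::field fps \<Rightarrow> nat \<Rightarrow> enat" where
  "lower_ramification p f n = fixpoint_mult (fps_iterate f (p ^ n)) - 1"

text \<open>The integers \<open>\<ell>\<^sub>i = \<ell> + (i - 1) p\<close>, used for \<open>i \<ge> 1\<close> only.\<close>
definition ell_seq :: "nat \<Rightarrow> nat \<Rightarrow> nat \<Rightarrow> nat" where
  "ell_seq p l i = l + (i - 1) * p"

text \<open>
  The coefficient of \<open>1/z\<close> in \<open>z\<^bsup>q - \<ell>\<^sub>i\<^esup> / (z - f(z))\<close>.  The natural-number subtraction
  does not truncate for \<open>1 \<le> i \<le> \<lceil>q/p\<rceil>\<close>, because then \<open>\<ell>\<^sub>i \<le> q\<close>.
\<close>
definition iota :: "nat \<Rightarrow> nat \<Rightarrow> nat \<Rightarrow> 'a::field fps \<Rightarrow> nat \<Rightarrow> 'a" where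
  "iota p q l f i =
     fls_residue (fls_X ^ (q - ell_seq p l i) / (fls_X - fps_to_fls f))"

end

theory Submission
  imports Defs
begin

text \<open>
  Composition with \<open>f\<close> is a field automorphism \<open>\<sigma>\<close> of the Laurent series field, and
  \<open>\<Delta> = \<sigma> - 1\<close>.  In characteristic \<open>p\<close> the automorphism attached to the \<open>p\<close>-th iterate
  is \<open>\<sigma>\<^sup>p = 1 + \<Delta>\<^sup>p\<close>, so ramification numbers are questions about how far powers of \<open>\<Delta>\<close>
  raise orders at zero.  If \<open>v = f(z) - z\<close> has order \<open>q + 1\<close>, then \<open>\<Delta>\<close> is the
  derivation \<open>v d/dz\<close> up to terms that raise orders by \<open>2q\<close> (lemma \<open>ord_ge_remainder\<close>).  In particular
  \<open>\<Delta>\<close> raises orders by at least \<open>q\<close>, and by exactly \<open>q\<close> on series of order prime to \<open>p\<close>.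

  The proof follows one series through the iteration: an approximate Fatou coordinate, that is a
  series \<open>y\<close> of order \<open>-q\<close> with \<open>\<Delta> y = 1 + \<epsilon>\<close>, where \<open>\<epsilon>\<close> has order \<open>\<mu> > 0\<close>.  A true Fatou
  coordinate (\<open>\<epsilon> = 0\<close>) would be a primitive of \<open>1/v\<close> for the derivation \<open>v d/dz\<close>; in characteristic
  \<open>p\<close> the coefficients of \<open>1/v\<close> at exponents congruent to \<open>-1\<close> modulo \<open>p\<close> cannot be integrated.
  Among these, the ones that matter are, up to sign, the numbers \<open>\<iota>\<^sub>i\<close>: integrating
  everything else gives \<open>y\<close> with \<open>\<mu> \<ge> \<ell>\<^sub>j\<close> if \<open>\<iota>\<^sub>i = 0\<close> for all \<open>i < j\<close>, and equality holds if moreover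
  \<open>\<iota>\<^sub>j \<noteq> 0\<close> and \<open>\<ell>\<^sub>j < q\<close> (lemma \<open>initial_fatou\<close>).

  A Fatou coordinate determines the next ramification number: \<open>\<eta> = \<sigma>\<^sup>p y - y = \<Delta>\<^sup>p\<^sup>-\<^sup>1 \<epsilon>\<close> has order
  \<open>i\<^sub>1 - q\<close> on the one hand, because \<open>p\<close> does not divide \<open>q\<close>, and order at least \<open>\<mu> + (p - 1)q\<close> on the
  other hand.  Hence \<open>i\<^sub>1 \<ge> pq + \<mu>\<close>, with equality if \<open>\<epsilon>\<close> has exact order \<open>\<mu>\<close> and \<open>\<mu>\<close> is
  congruent to \<open>q\<close> modulo \<open>p\<close>.

  The iteration works because \<open>f\<^sup>p\<close> inherits a Fatou coordinate with the same \<open>\<mu>\<close>.  Dividing \<open>y\<close> by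
  \<open>\<eta>\<close> suggests itself, but \<open>\<eta>\<close> moves under \<open>\<sigma>\<^sup>p\<close>.  The identity \<open>\<Delta> \<eta> = (\<sigma>\<^sup>p - 1) \<epsilon>\<close> says that
  \<open>\<Delta> \<eta>\<close> has unexpectedly high order, so \<open>\<eta>\<close> agrees with a series \<open>\<zeta>\<close> in \<open>z\<^sup>p\<close> up to relative order
  \<open>\<mu>\<close> (lemmas \<open>ord_deriv_\<eta>\<close> and \<open>ord_\<chi>\<close>).  As the derivative of \<open>\<zeta>\<close> vanishes, \<open>\<sigma>\<^sup>p\<close> hardly moves \<open>\<zeta>\<close>, and
  \<open>y / \<zeta>\<close> is the required coordinate for \<open>f\<^sup>p\<close>.  So the recursion \<open>i\<^sub>n\<^sub>+\<^sub>1 = p i\<^sub>n + \<mu>\<close>, or \<open>\<ge>\<close>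
  in the inexact case, holds for all \<open>n\<close>.

  If some \<open>\<iota>\<^sub>i\<close> with \<open>\<ell>\<^sub>i < q\<close> is non-zero, the exact recursion for the first such \<open>i\<close> gives the formula
  for \<open>\<ell>\<^sub>i\<close> and, since the formula is injective in \<open>i\<close>, for no other index.  If there is none, the
  inexact recursion with \<open>\<mu> = q\<close> puts every \<open>i\<^sub>n\<close> with \<open>n \<ge> 1\<close> above all the values in question.
\<close>

unbundle Formal_Power_Series.fps_syntax and Formal_Laurent_Series.fps_syntax

section \<open>Orders of Laurent series\<close>

text \<open>
  The zero series satisfies every bound, although \<^const>\<open>fls_subdegree\<close> sends it to \<open>0\<close>.
\<close>
definition ord_ge :: "int \<Rightarrow> 'a::zero fls \<Rightarrow> bool" where
  "ord_ge n g \<longleftrightarrow> (\<forall>k<n. g $$ k = 0)"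

lemma ord_ge_iff_subdegree: "ord_ge n g \<longleftrightarrow> g = 0 \<or> n \<le> fls_subdegree g"
  unfolding ord_ge_def using fls_subdegree_geI[of g n] by auto

lemma ord_ge_0 [simp]: "ord_ge n 0"
  by (simp add: ord_ge_def)

lemma ord_ge_1: "ord_ge 0 1"
  by (simp add: ord_ge_def)

lemma ord_ge_mono: "ord_ge n g \<Longrightarrow> m \<le> n \<Longrightarrow> ord_ge m g"
  by (simp add: ord_ge_def)

lemma ord_ge_nth: "ord_ge n g \<Longrightarrow> k < n \<Longrightarrow> g $$ k = 0"
  by (simp add: ord_ge_def)

lemma ord_ge_add: "ord_ge n a \<Longrightarrow> ord_ge n b \<Longrightarrow> ord_ge n (a + b)"
  and ord_ge_diff: "ord_ge n c \<Longrightarrow> ord_ge n d \<Longrightarrow> ord_ge n (c - d)"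
  for a b :: "'a::monoid_add fls" and c d :: "'b::group_add fls"
  by (simp_all add: ord_ge_def)

lemma ord_ge_mult:
  fixes a b :: "'a::field fls"
  assumes "ord_ge m a" "ord_ge n b"
  shows "ord_ge (m + n) (a * b)"
  using assms unfolding ord_ge_iff_subdegree
  by (cases "a = 0"; cases "b = 0") (auto simp: add_mono)

text \<open>If a factor has order strictly above its bound, then both sides vanish.\<close>
lemma nth_mult_ord_ge:
  fixes a b :: "'a::field fls"
  assumes "ord_ge m a" "ord_ge n b"
  shows "(a * b) $$ (m + n) = a $$ m * b $$ n"
proof (cases "a = 0 \<or> b = 0")
  case False
  then have le: "m \<le> fls_subdegree a" "n \<le> fls_subdegree b"
    using assms by (auto simp: ord_ge_iff_subdegree)
  show ?thesis
  proof (cases "m = fls_subdegree a \<and> n = fls_subdegree b")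
    case True
    then show ?thesis by simp
  next
    case neq: False
    then have "m + n < fls_subdegree a + fls_subdegree b" "a $$ m = 0 \<or> b $$ n = 0"
      using le by auto
    then show ?thesis by (auto simp: fls_times_nth_eq0)
  qed
qed auto

lemma ord_ge_cancel_left:
  fixes a b :: "'a::field fls"
  assumes "a \<noteq> 0" "ord_ge (fls_subdegree a + n) (a * b)"
  shows "ord_ge n b"
  using assms by (cases "b = 0") (auto simp: ord_ge_iff_subdegree)

lemma ord_ge_deriv: "ord_ge n g \<Longrightarrow> ord_ge (n - 1) (fls_deriv g)"
  by (simp add: ord_ge_def)

lemma ord_ge_integral:
  fixes g :: "'a::field fls"
  shows "ord_ge n g \<Longrightarrow> ord_ge (n + 1) (fls_integral g)"
  by (simp add: ord_ge_def)

lemma ord_ge_remove_leading: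
  fixes g :: "'a::field fls"
  assumes "ord_ge m g"
  shows "ord_ge (m + 1) (g - fls_const (g $$ m) * fls_X powi m)"
  using assms unfolding ord_ge_def by auto

section \<open>Powers of a difference operator in prime characteristic\<close>

lemma of_int_eq_0_iff_CHAR:
  "of_int k = (0 :: 'a::ring_1) \<longleftrightarrow> int CHAR('a) dvd k"
proof (cases k rule: int_cases2)
  case (nonneg n)
  then show ?thesis by (simp add: of_nat_eq_0_iff_char_dvd)
next
  case (nonpos n)
  then show ?thesis by (simp add: of_nat_eq_0_iff_char_dvd)
qed

text \<open>
  The binomial theorem for \<open>(1 + D)\<^sup>n\<close>, where \<open>S = 1 + D\<close> is an additive map.
\<close>
lemma funpow_additive_binomial:
  fixes S :: "'a::comm_ring_1 \<Rightarrow> 'a"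
  assumes add: "\<And>a b. S (a + b) = S a + S b"
  defines "D \<equiv> \<lambda>a. S a - a"
  shows "(S ^^ n) a = (\<Sum>k\<le>n. of_nat (n choose k) * (D ^^ k) a)"
proof (induction n)
  case (Suc n)
  have S0: "S 0 = 0" using add[of 0 0] by simp
  have S_of_nat: "S (of_nat c * b) = of_nat c * S b" for c b
    by (induction c) (simp_all add: S0 add algebra_simps)
  have S_sum: "S (\<Sum>k\<in>A. h k) = (\<Sum>k\<in>A. S (h k))" if "finite A" for A :: "nat set" and h
    using that by induction (simp_all add: S0 add)
  have "(S ^^ Suc n) a = (\<Sum>k\<le>n. of_nat (n choose k) * S ((D ^^ k) a))"
    by (simp add: Suc S_sum S_of_nat)
  also have "\<dots> = (\<Sum>k\<le>n. of_nat (n choose k) * (D ^^ k) a)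
                 + (\<Sum>k\<le>n. of_nat (n choose k) * (D ^^ Suc k) a)"
    by (simp add: D_def sum.distrib[symmetric] algebra_simps)
  also have "(\<Sum>k\<le>n. of_nat (n choose k) * (D ^^ k) a)
      = a + (\<Sum>k\<le>n. of_nat (n choose Suc k) * (D ^^ Suc k) a)"
  proof -
    have "(\<Sum>k\<le>n. of_nat (n choose k) * (D ^^ k) a)
        = (\<Sum>k\<le>Suc n. of_nat (n choose k) * (D ^^ k) a)"
      by (simp add: binomial_eq_0)
    also have "\<dots> = a + (\<Sum>k\<le>n. of_nat (n choose Suc k) * (D ^^ Suc k) a)"
      by (subst sum.atMost_Suc_shift) simp
    finally show ?thesis .
  qed
  also have "a + (\<Sum>k\<le>n. of_nat (n choose Suc k) * (D ^^ Suc k) a)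
        + (\<Sum>k\<le>n. of_nat (n choose k) * (D ^^ Suc k) a)
      = a + (\<Sum>k\<le>n. of_nat (Suc n choose Suc k) * (D ^^ Suc k) a)"
    by (simp add: sum.distrib[symmetric] algebra_simps del: funpow.simps)
  also have "\<dots> = (\<Sum>k\<le>Suc n. of_nat (Suc n choose k) * (D ^^ k) a)"
    by (subst sum.atMost_Suc_shift) (simp del: funpow.simps(2) binomial_Suc_Suc)
  finally show ?case .
qed simp

text \<open>The Frobenius identity \<open>(S - 1)\<^sup>p = S\<^sup>p - 1\<close> in the ring of additive maps.\<close>
lemma funpow_diff_prime_char:
  fixes S :: "'a::comm_ring_1 \<Rightarrow> 'a"
  assumes add: "\<And>a b. S (a + b) = S a + S b" and p: "prime CHAR('a)"
  shows "((\<lambda>a. S a - a) ^^ CHAR('a)) a = (S ^^ CHAR('a)) a - a"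
proof -
  let ?p = "CHAR('a)" and ?D = "\<lambda>a. S a - a"
  have p1: "1 < ?p" using p prime_gt_1_nat by blast
  have "(S ^^ ?p) a = (\<Sum>k\<le>?p. of_nat (?p choose k) * (?D ^^ k) a)"
    by (rule funpow_additive_binomial[where S = S, OF add])
  also have "\<dots> = (\<Sum>k\<in>{0, ?p}. of_nat (?p choose k) * (?D ^^ k) a)"
  proof (rule sum.mono_neutral_right)
    show "\<forall>k\<in>{..?p} - {0, ?p}. of_nat (?p choose k) * (?D ^^ k) a = 0"
    proof
      fix k assume "k \<in> {..?p} - {0, ?p}"
      then have "?p dvd ?p choose k"
        using p by (intro dvd_choose_prime) auto
      then have "of_nat (?p choose k) = (0 :: 'a)"
        by (simp only: of_nat_eq_0_iff_char_dvd)
      then show "of_nat (?p choose k) * (?D ^^ k) a = 0" by simp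
    qed
  qed auto
  also have "\<dots> = a + (?D ^^ ?p) a"
    using p1 by simp
  finally show ?thesis by simp
qed

section \<open>Iterates of a power series\<close>

lemma fps_iterate_Suc: "fps_iterate f (Suc n) = f oo fps_iterate f n"
  by (simp add: fps_iterate_def)

lemma fps_iterate_0: "fps_iterate f 0 = fps_X"
  by (simp add: fps_iterate_def)

lemma fps_iterate_nth_0: "f $ 0 = 0 \<Longrightarrow> fps_iterate f n $ 0 = 0"
  by (induction n) (simp_all add: fps_iterate_0 fps_iterate_Suc)

lemma fps_iterate_nz: "f $ 0 = 0 \<Longrightarrow> f \<noteq> 0 \<Longrightarrow> fps_iterate f n \<noteq> 0"
  by (induction n)
     (auto simp: fps_iterate_0 fps_iterate_Suc fps_compose_eq_0_iff fps_iterate_nth_0)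

text \<open>
  Composition acts on the right, but \<^const>\<open>fps_iterate\<close> composes on the left; associativity
  reconciles the two.
\<close>
lemma fls_compose_fps_iterate:
  assumes "f $ 0 = 0" "f \<noteq> (0 :: 'a::field fps)"
  shows "fls_compose_fps g (fps_iterate f n) = ((\<lambda>g. fls_compose_fps g f) ^^ n) g"
proof (induction n arbitrary: g)
  case 0
  show ?case
  proof (cases "g = 0")
    case False
    then show ?thesis
      by (simp add: fps_iterate_0 fls_compose_fps_def fls_X_power_int fls_times_both_shifted_simp)
  qed (simp add: fps_iterate_0)
next
  case (Suc n)
  show ?case
    unfolding fps_iterate_Suc funpow_Suc_right o_def
    by (subst fls_compose_fps_assoc[symmetric])
       (use assms in \<open>auto simp: Suc.IH fps_iterate_nth_0 fps_iterate_nz\<close>)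
qed

lemma fps_iterate_mult:
  assumes "f $ 0 = 0"
  shows "fps_iterate f (m * n) = fps_iterate (fps_iterate f m) n"
proof -
  have shift: "(fps_compose f ^^ m) g = fps_iterate f m oo g" if "g $ 0 = 0" for g m
    using that
  proof (induction m)
    case (Suc m)
    then show ?case
      by (simp add: fps_iterate_Suc fps_compose_assoc fps_iterate_nth_0 assms)
  qed (simp add: fps_iterate_0)
  show ?thesis
  proof (induction n)
    case (Suc n)
    have "fps_iterate f (m * Suc n) = (fps_compose f ^^ m) (fps_iterate f (m * n))"
      by (simp add: fps_iterate_def funpow_add)
    also have "\<dots> = fps_iterate f m oo fps_iterate f (m * n)"
      by (rule shift) (rule fps_iterate_nth_0[OF assms])
    finally show ?case by (simp add: Suc fps_iterate_Suc)
  qed (simp add: fps_iterate_0)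
qed

lemma fps_iterate_power_Suc:
  "f $ 0 = 0 \<Longrightarrow> fps_iterate f (p ^ Suc n) = fps_iterate (fps_iterate f (p ^ n)) p"
  by (simp add: fps_iterate_mult[symmetric] mult.commute)

lemma fps_iterate_fps_X: "fps_iterate fps_X n = (fps_X :: 'a::field fps)"
  by (induction n) (simp_all add: fps_iterate_0 fps_iterate_Suc)

section \<open>Composition with a series tangent to the identity\<close>

definition comp_diff :: "'a::field fps \<Rightarrow> 'a fls \<Rightarrow> 'a fls" where
  "comp_diff f g = fls_compose_fps g f - g"

locale tangent_series =
  fixes f :: "'k::field fps" and q :: nat
  assumes f_0: "f $ 0 = 0"
    and q_pos: "0 < q"
    and subdegree_diff: "subdegree (f - fps_X) = q + 1"
begin

definition v :: "'k fls" where
  "v = fps_to_fls f - fls_X"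

abbreviation \<Delta> :: "'k fls \<Rightarrow> 'k fls" where
  "\<Delta> \<equiv> comp_diff f"

lemma v_eq: "v = fps_to_fls (f - fps_X)"
  by (intro fls_eqI) (simp add: v_def)

lemma subdegree_v: "fls_subdegree v = int q + 1"
  unfolding v_eq fls_subdegree_fls_to_fps subdegree_diff by simp

lemma v_nz: "v \<noteq> 0"
  using subdegree_v by auto

lemma ord_ge_v: "ord_ge (int q + 1) v"
  by (simp add: ord_ge_iff_subdegree subdegree_v)

abbreviation v0 :: 'k where "v0 \<equiv> v $$ (int q + 1)"

lemma v0_nz: "v0 \<noteq> 0"
  using v_nz nth_fls_subdegree_nonzero[of v] by (simp add: subdegree_v)

lemma f_1: "f $ 1 = 1"
proof -
  have "(f - fps_X) $ 1 = 0"
    by (rule nth_less_subdegree_zero) (unfold subdegree_diff, use q_pos in simp)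
  then show ?thesis by simp
qed

lemma f_nz: "f \<noteq> 0"
  using f_1 by auto

lemma subdegree_f: "subdegree f = 1"
  by (rule subdegreeI) (use f_0 f_1 in auto)

lemma compose_add: "fls_compose_fps (a + b) f = fls_compose_fps a f + fls_compose_fps b f"
  by (simp add: fls_compose_fps_add f_0 f_nz)

lemma compose_mult: "fls_compose_fps (a * b) f = fls_compose_fps a f * fls_compose_fps b f"
  by (simp add: fls_compose_fps_mult f_0 f_nz)

lemma \<Delta>_add: "\<Delta> (a + b) = \<Delta> a + \<Delta> b"
  by (simp add: comp_diff_def compose_add)

lemma \<Delta>_diff: "\<Delta> (a - b) = \<Delta> a - \<Delta> b"
  by (simp add: comp_diff_def fls_compose_fps_diff f_0 f_nz)

lemma \<Delta>_1: "\<Delta> 1 = 0"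
  by (simp add: comp_diff_def)

lemma \<Delta>_const_mult: "\<Delta> (fls_const c * a) = fls_const c * \<Delta> a"
  by (simp add: comp_diff_def compose_mult algebra_simps)

lemma \<Delta>_mult: "\<Delta> (a * b) = a * \<Delta> b + b * \<Delta> a + \<Delta> a * \<Delta> b"
  by (simp add: comp_diff_def compose_mult algebra_simps)

text \<open>The error in the Taylor approximation \<open>g(z + v) - g(z) \<approx> v g'(z)\<close>.\<close>
definition remainder :: "'k fls \<Rightarrow> 'k fls" where
  "remainder g = \<Delta> g - v * fls_deriv g"

lemma \<Delta>_eq: "\<Delta> g = v * fls_deriv g + remainder g"
  by (simp add: remainder_def)

lemma ord_ge_v_deriv: "ord_ge n g \<Longrightarrow> ord_ge (n + int q) (v * fls_deriv g)"
  using ord_ge_mult[OF ord_ge_v ord_ge_deriv] by (simp add: algebra_simps)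

lemma ord_ge_\<Delta>_if_remainder:
  assumes "ord_ge n g" "ord_ge (n + 2 * int q) (remainder g)"
  shows "ord_ge (n + int q) (\<Delta> g)"
  unfolding \<Delta>_eq
  by (intro ord_ge_add ord_ge_v_deriv assms ord_ge_mono[OF assms(2)]) simp

lemma remainder_mult:
  "remainder (a * b) = a * remainder b + b * remainder a + \<Delta> a * \<Delta> b"
  by (simp add: remainder_def \<Delta>_mult algebra_simps)

text \<open>
  The second-order bound is multiplicative: the cross term \<open>\<Delta> a * \<Delta> b\<close> gains \<open>q\<close> from each factor.
  So it passes from \<open>z\<close> and \<open>1/z\<close> to all monomials.
\<close>
lemma ord_ge_remainder_mult:
  assumes a: "ord_ge m a" "ord_ge (m + 2 * int q) (remainder a)"
    and b: "ord_ge n b" "ord_ge (n + 2 * int q) (remainder b)"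
  shows "ord_ge (m + n + 2 * int q) (remainder (a * b))"
  using ord_ge_mult[OF a(1) b(2)] ord_ge_mult[OF b(1) a(2)]
    ord_ge_mult[OF ord_ge_\<Delta>_if_remainder[OF a] ord_ge_\<Delta>_if_remainder[OF b]]
  unfolding remainder_mult by (intro ord_ge_add) (simp_all add: algebra_simps)

lemma ord_ge_remainder_power:
  assumes a: "ord_ge m a" "ord_ge (m + 2 * int q) (remainder a)"
  shows "ord_ge (int i * m) (a ^ i) \<and> ord_ge (int i * m + 2 * int q) (remainder (a ^ i))"
proof (induction i)
  case 0
  then show ?case by (simp add: ord_ge_1 remainder_def \<Delta>_1)
next
  case (Suc i)
  then show ?case
    using ord_ge_mult[OF a(1), of "int i * m" "a ^ i"]
      ord_ge_remainder_mult[OF a, of "int i * m" "a ^ i"]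
    by (simp add: algebra_simps)
qed

lemma remainder_X: "remainder fls_X = 0"
  by (simp add: remainder_def comp_diff_def v_def f_0)

lemma ord_ge_remainder_X_inverse: "ord_ge (- 1 + 2 * int q) (remainder (inverse fls_X))"
proof -
  let ?F = "fps_to_fls f"
  have F: "?F \<noteq> 0" using f_nz by simp
  have "fls_compose_fps fls_X_inv f = inverse ?F"
    using fls_compose_fps_inverse[of f fls_X] by (simp add: f_0 f_nz fls_inverse_X)
  then have "remainder (inverse fls_X) = inverse ?F - inverse fls_X + v * (inverse fls_X)\<^sup>2"
    by (simp add: remainder_def comp_diff_def fls_inverse_X)
  also have "\<dots> = v ^ 2 * (inverse ?F * (inverse fls_X) ^ 2)"
  proof -
    have "inverse a - inverse b + (a - b) * (inverse b)\<^sup>2 = (a - b) ^ 2 * (inverse a * (inverse b) ^ 2)"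
      if "a \<noteq> 0" "b \<noteq> 0" for a b :: "'k fls"
      using that by (simp add: field_simps power2_eq_square)
    from this[OF F, of fls_X] show ?thesis by (simp add: v_def)
  qed
  finally show ?thesis
    using F v_nz by (simp add: ord_ge_iff_subdegree subdegree_v fls_subdegree_pow
        fls_subdegree_fls_to_fps subdegree_f)
qed

lemma ord_ge_remainder_X_powi: "ord_ge (m + 2 * int q) (remainder (fls_X powi m))"
proof (cases m rule: int_cases2)
  case (nonneg n)
  then show ?thesis
    using ord_ge_remainder_power[of 1 fls_X n]
    by (simp add: ord_ge_iff_subdegree remainder_X)
next
  case (nonpos n)
  then show ?thesis
    using ord_ge_remainder_power[of "-1" "inverse fls_X" n] ord_ge_remainder_X_inverse
    by (simp add: ord_ge_iff_subdegree power_int_minus power_inverse)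
qed

lemma ord_ge_compose: "ord_ge n g \<Longrightarrow> ord_ge n (fls_compose_fps g f)"
  by (auto simp: ord_ge_iff_subdegree f_0 subdegree_f)

text \<open>
  For general \<open>g\<close> the Taylor error is not an obvious sum over monomials, as \<open>g\<close> has infinitely many
  terms.  Only \<open>2q\<close> of them count: the bound with a gain of \<open>0\<close> is trivial, and splitting off one
  leading term improves the gain by one, until the bound for monomials is exhausted.
\<close>
lemma ord_ge_remainder:
  assumes "ord_ge n g"
  shows "ord_ge (n + 2 * int q) (remainder g)"
proof -
  have "ord_ge (n + int d) (remainder g)" if "d \<le> 2 * q" for d
    using that assms
  proof (induction d arbitrary: n g)
    case 0
    then show ?case
      unfolding remainder_def comp_diff_def
      by (auto intro!: ord_ge_diff ord_ge_compose ord_ge_mono[OF ord_ge_v_deriv])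
  next
    case (Suc d)
    define t where "t = fls_const (g $$ n) * fls_X powi n"
    have "remainder t = fls_const (g $$ n) * remainder (fls_X powi n)"
      by (simp add: t_def remainder_def \<Delta>_const_mult algebra_simps)
    then have "ord_ge (n + 2 * int q) (remainder t)"
      using ord_ge_remainder_X_powi[of n] ord_ge_mult[of 0 "fls_const (g $$ n)"]
      by (simp add: ord_ge_iff_subdegree[of 0])
    then have t: "ord_ge (n + int (Suc d)) (remainder t)"
      by (rule ord_ge_mono) (use Suc.prems in simp)
    have "ord_ge (n + 1 + int d) (remainder (g - t))"
      using Suc.IH[of "n + 1" "g - t"] Suc.prems ord_ge_remove_leading[of n g]
      by (simp add: t_def)
    then have "ord_ge (n + int (Suc d)) (remainder t + remainder (g - t))"
      by (intro ord_ge_add t) (simp add: algebra_simps)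
    then show ?case
      by (simp add: remainder_def \<Delta>_diff algebra_simps)
  qed
  from this[of "2 * q"] show ?thesis by simp
qed

lemma ord_ge_\<Delta>: "ord_ge n g \<Longrightarrow> ord_ge (n + int q) (\<Delta> g)"
  by (intro ord_ge_\<Delta>_if_remainder ord_ge_remainder)

lemma nth_\<Delta>:
  assumes "ord_ge n g"
  shows "\<Delta> g $$ (n + int q) = of_int n * v0 * g $$ n"
proof -
  have "remainder g $$ (n + int q) = 0"
    using ord_ge_nth[OF ord_ge_remainder[OF assms]] q_pos by simp
  moreover have "(v * fls_deriv g) $$ (n + int q) = v0 * (of_int n * g $$ n)"
    using nth_mult_ord_ge[OF ord_ge_v ord_ge_deriv[OF assms]] by (simp add: algebra_simps)
  ultimately show ?thesis by (simp add: \<Delta>_eq)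
qed

lemma ord_ge_\<Delta>_funpow: "ord_ge n g \<Longrightarrow> ord_ge (n + int (k * q)) ((\<Delta> ^^ k) g)"
proof (induction k)
  case (Suc k)
  then show ?case using ord_ge_\<Delta>[of "n + int (k * q)"] by (simp add: algebra_simps)
qed simp

lemma \<Delta>_prime_funpow:
  assumes "prime CHAR('k)"
  shows "(\<Delta> ^^ CHAR('k)) g = comp_diff (fps_iterate f CHAR('k)) g"
proof -
  have "CHAR('k fls) = CHAR('k)" by simp
  with funpow_diff_prime_char[of "\<lambda>g. fls_compose_fps g f" g] assms
  show ?thesis
    by (simp add: compose_add fls_compose_fps_iterate f_0 f_nz comp_diff_def[abs_def])
qed

end

lemma comp_diff_fps_X: "comp_diff fps_X g = (0 :: 'k::field fls)"
  using fls_compose_fps_iterate[of "fps_X :: 'k fps" g 0]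
  by (simp add: fps_iterate_0 comp_diff_def)

section \<open>Approximate Fatou coordinates\<close>

text \<open>
  A Fatou coordinate conjugates a map to the translation by \<open>1\<close>.  Here the equation
  \<open>y(f(z)) = y(z) + 1\<close> holds only up to terms of order \<open>\<mu>\<close>.
\<close>
definition approx_fatou :: "'k::field fps \<Rightarrow> nat \<Rightarrow> nat \<Rightarrow> 'k fls \<Rightarrow> bool" where
  "approx_fatou f q \<mu> y \<longleftrightarrow> ord_ge (- int q) y \<and> ord_ge (int \<mu>) (comp_diff f y - 1)"

locale wild_fatou = tangent_series f q for f :: "'k::field fps" and q +
  fixes p \<mu> :: nat and y :: "'k fls"
  assumes prime_p: "prime p" and CHAR_p: "CHAR('k) = p"
    and q_coprime: "\<not> p dvd q"
    and \<mu>_pos: "0 < \<mu>" and \<mu>_le: "\<mu> \<le> q"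
    and fatou: "approx_fatou f q \<mu> y"
begin

definition \<epsilon> :: "'k fls" where "\<epsilon> = \<Delta> y - 1"

abbreviation g :: "'k fps" where "g \<equiv> fps_iterate f p"

definition \<eta> :: "'k fls" where "\<eta> = comp_diff g y"

lemma of_int_eq_0: "of_int k = (0::'k) \<longleftrightarrow> int p dvd k"
  by (simp add: of_int_eq_0_iff_CHAR CHAR_p)

lemma p_gt_1: "1 < p"
  using prime_p prime_gt_1_nat by blast

lemma ord_y: "ord_ge (- int q) y" and ord_\<epsilon>: "ord_ge (int \<mu>) \<epsilon>"
  using fatou by (simp_all add: approx_fatou_def \<epsilon>_def)

lemma \<Delta>_y: "\<Delta> y = 1 + \<epsilon>"
  by (simp add: \<epsilon>_def)

text \<open>
  The order of \<open>y\<close> is exactly \<open>-q\<close>: otherwise \<open>\<Delta> y\<close> would have no constant term.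
\<close>
lemma y_leading: "y $$ (- int q) \<noteq> 0"
proof -
  have "\<Delta> y $$ 0 = 1"
    using ord_ge_nth[OF ord_\<epsilon>, of 0] \<mu>_pos by (simp add: \<Delta>_y)
  with nth_\<Delta>[OF ord_y] show ?thesis by auto
qed

lemma comp_diff_g: "comp_diff g a = (\<Delta> ^^ p) a"
  using \<Delta>_prime_funpow prime_p by (simp add: CHAR_p)

text \<open>The first \<open>\<Delta>\<close> turns \<open>y\<close> into \<open>1 + \<epsilon>\<close> and the second one kills the constant.\<close>
lemma \<eta>_eq: "\<eta> = (\<Delta> ^^ (p - 1)) \<epsilon>"
proof -
  obtain r where r: "p = Suc (Suc r)"
    using p_gt_1 by (auto dest: less_imp_Suc_add)
  have "\<eta> = (\<Delta> ^^ r) (\<Delta> (1 + \<epsilon>))"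
    unfolding \<eta>_def comp_diff_g unfolding r by (simp add: funpow_Suc_right \<Delta>_y del: funpow.simps)
  also have "\<Delta> (1 + \<epsilon>) = \<Delta> \<epsilon>"
    by (simp add: \<Delta>_add \<Delta>_1)
  also have "(\<Delta> ^^ r) (\<Delta> \<epsilon>) = (\<Delta> ^^ (p - 1)) \<epsilon>"
    by (simp add: r funpow_Suc_right del: funpow.simps)
  finally show ?thesis .
qed

lemma \<Delta>_\<eta>: "\<Delta> \<eta> = comp_diff g \<epsilon>"
proof -
  have "(\<Delta> ^^ Suc (p - 1)) \<epsilon> = (\<Delta> ^^ p) \<epsilon>"
    using p_gt_1 by simp
  then show ?thesis by (simp add: \<eta>_eq comp_diff_g)
qed

lemma ord_\<eta>_lower: "ord_ge (int \<mu> + int ((p - 1) * q)) \<eta>"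
  unfolding \<eta>_eq by (rule ord_ge_\<Delta>_funpow) (rule ord_\<epsilon>)

text \<open>
  If \<open>\<epsilon>\<close> has exact order \<open>\<mu>\<close> congruent to \<open>q\<close>, then the orders of \<open>\<epsilon>, \<Delta> \<epsilon>, \<Delta>\<^sup>2 \<epsilon>, \<dots>\<close> are congruent to
  \<open>q, 2q, 3q, \<dots>\<close>.  The first multiple of \<open>p\<close> is reached after exactly \<open>p - 1\<close> steps, so none of these
  steps raises the order by more than \<open>q\<close>.
\<close>
lemma nth_\<eta>_nz:
  assumes cong: "of_nat \<mu> = (of_nat q :: 'k)" and nz: "\<epsilon> $$ int \<mu> \<noteq> 0"
  shows "\<eta> $$ (int \<mu> + int ((p - 1) * q)) \<noteq> 0"
proof -
  have "(\<Delta> ^^ k) \<epsilon> $$ (int \<mu> + int (k * q)) \<noteq> 0" if "k \<le> p - 1" for k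
    using that
  proof (induction k)
    case 0
    then show ?case using nz by simp
  next
    case (Suc k)
    have "(\<Delta> ^^ Suc k) \<epsilon> $$ (int \<mu> + int (Suc k * q))
        = of_int (int \<mu> + int (k * q)) * v0 * (\<Delta> ^^ k) \<epsilon> $$ (int \<mu> + int (k * q))"
      using nth_\<Delta>[OF ord_ge_\<Delta>_funpow[OF ord_\<epsilon>, of k]] by (simp add: algebra_simps)
    moreover have "of_int (int \<mu> + int (k * q)) = (of_nat (Suc k * q) :: 'k)"
      by (simp add: cong algebra_simps)
    moreover have "\<not> p dvd Suc k * q"
      using prime_p q_coprime Suc.prems p_gt_1
      by (auto simp: prime_dvd_mult_iff simp del: mult_Suc dest: dvd_imp_le)
    then have "of_nat (Suc k * q) \<noteq> (0 :: 'k)"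
      by (simp only: of_nat_eq_0_iff_char_dvd CHAR_p not_False_eq_True)
    ultimately show ?case using Suc v0_nz by simp
  qed
  from this[of "p - 1"] show ?thesis by (simp add: \<eta>_eq)
qed

end

section \<open>Passing to the p-th iterate\<close>

locale wild_fatou_step = wild_fatou f q p \<mu> y
  for f :: "'k::field fps" and q p \<mu> and y +
  assumes g_nontrivial: "fps_iterate f p \<noteq> fps_X"
begin

definition q1 :: nat where "q1 = subdegree (g - fps_X) - 1"

lemma g_0: "g $ 0 = 0"
  by (rule fps_iterate_nth_0) (rule f_0)

lemma comp_diff_g_X: "comp_diff g fls_X = fps_to_fls (g - fps_X)"
  using g_0 by (simp add: comp_diff_def)

lemma subdegree_g: "subdegree (g - fps_X) = q1 + 1" and q1_pos: "0 < q1"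
proof -
  have "ord_ge (1 + int (p * q)) (comp_diff g fls_X)"
    unfolding comp_diff_g by (rule ord_ge_\<Delta>_funpow) (simp add: ord_ge_iff_subdegree)
  then have "1 + int (p * q) \<le> int (subdegree (g - fps_X))"
    using g_nontrivial
    unfolding comp_diff_g_X ord_ge_iff_subdegree fls_subdegree_fls_to_fps fps_to_fls_eq_0_iff
      right_minus_eq
    by blast
  then have "1 + p * q \<le> subdegree (g - fps_X)" by linarith
  moreover have "0 < p * q" using p_gt_1 q_pos by simp
  ultimately show "subdegree (g - fps_X) = q1 + 1" "0 < q1"
    unfolding q1_def by linarith+
qed

sublocale G: tangent_series g q1
  by unfold_locales (rule g_0 q1_pos subdegree_g)+

text \<open>The order of \<open>\<eta>\<close>.\<close>
definition N :: int where "N = int q1 - int q"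

lemma ord_\<eta>: "ord_ge N \<eta>"
  using G.ord_ge_\<Delta>[OF ord_y] by (simp add: \<eta>_def N_def)

lemma \<eta>_leading: "\<eta> $$ N \<noteq> 0"
proof -
  have "\<eta> $$ N = of_int (- int q) * G.v0 * y $$ (- int q)"
    using G.nth_\<Delta>[OF ord_y] by (simp add: \<eta>_def N_def)
  moreover have "of_int (- int q) \<noteq> (0 :: 'k)"
    unfolding of_int_eq_0 using q_coprime by simp
  ultimately show ?thesis using G.v0_nz y_leading by simp
qed

lemma q1_ge: "p * q + \<mu> \<le> q1"
proof -
  have "int \<mu> + int ((p - 1) * q) \<le> N"
    using ord_ge_nth[OF ord_\<eta>_lower, of N] \<eta>_leading by force
  moreover have "(p - 1) * q + q = p * q"
    using p_gt_1 by (cases p) simp_all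
  ultimately show ?thesis unfolding N_def by linarith
qed

lemma q1_ge_q: "q \<le> q1"
proof -
  have "1 * q \<le> p * q" using p_gt_1 by (intro mult_right_mono) simp_all
  with q1_ge show ?thesis by linarith
qed

lemma N_nonneg: "0 \<le> N"
  using q1_ge_q by (simp add: N_def)

lemma ord_\<Delta>_\<eta>: "ord_ge (int \<mu> + int q1) (\<Delta> \<eta>)"
  unfolding \<Delta>_\<eta> by (rule G.ord_ge_\<Delta>) (rule ord_\<epsilon>)

text \<open>
  If \<open>p\<close> did not divide \<open>N\<close>, then \<open>\<Delta> \<eta>\<close> would have order \<open>N + q = q1\<close>.  But
  \<open>\<Delta> \<eta> = (\<sigma>\<^sup>p - 1) \<epsilon>\<close> has order at least \<open>q1 + \<mu>\<close>.  So \<open>q1\<close> is congruent to \<open>q\<close> modulo \<open>p\<close>, which is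
  the first of Sen's congruences for ramification numbers; in particular \<open>q1\<close> is again prime to \<open>p\<close>.
\<close>
lemma of_int_N: "of_int N = (0 :: 'k)"
proof -
  have "\<Delta> \<eta> $$ (N + int q) = 0"
    by (rule ord_ge_nth[OF ord_\<Delta>_\<eta>]) (use \<mu>_pos in \<open>simp add: N_def\<close>)
  with nth_\<Delta>[OF ord_\<eta>] \<eta>_leading v0_nz show ?thesis by simp
qed

lemma q1_coprime: "\<not> p dvd q1"
proof
  assume "p dvd q1"
  moreover have "int p dvd N" using of_int_N by (simp add: of_int_eq_0)
  ultimately have "int p dvd int q1 - N" by (intro dvd_diff) simp_all
  then show False using q_coprime by (simp add: N_def)
qed

text \<open>
  The Taylor error of \<open>\<eta>\<close> has order at least \<open>N + 2q\<close>, which is at least \<open>N + q + \<mu>\<close>, so the high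
  order of \<open>\<Delta> \<eta>\<close> is inherited by \<open>v \<eta>'\<close>.
\<close>
lemma ord_deriv_\<eta>: "ord_ge (N + int \<mu> - 1) (fls_deriv \<eta>)"
proof (rule ord_ge_cancel_left[OF v_nz])
  have "ord_ge (N + int \<mu> + int q) (\<Delta> \<eta> - remainder \<eta>)"
    by (intro ord_ge_diff ord_ge_mono[OF ord_\<Delta>_\<eta>] ord_ge_mono[OF ord_ge_remainder[OF ord_\<eta>]])
       (use \<mu>_le in \<open>simp_all add: N_def\<close>)
  then show "ord_ge (fls_subdegree v + (N + int \<mu> - 1)) (v * fls_deriv \<eta>)"
    by (simp add: \<Delta>_eq subdegree_v algebra_simps)
qed

text \<open>
  In characteristic \<open>p\<close>, integration uses \<open>inverse 0 = 0\<close>; integrating \<open>\<eta>'\<close> therefore recovers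
  precisely the terms of \<open>\<eta>\<close> whose exponents are not divisible by \<open>p\<close>.  The rest, \<open>\<zeta>\<close>, is a series
  in \<open>z\<^sup>p\<close>.
\<close>
definition \<chi> :: "'k fls" where "\<chi> = fls_integral (fls_deriv \<eta>)"
definition \<zeta> :: "'k fls" where "\<zeta> = \<eta> - \<chi>"

lemma ord_\<chi>: "ord_ge (N + int \<mu>) \<chi>"
  using ord_ge_integral[OF ord_deriv_\<eta>] by (simp add: \<chi>_def)

lemma deriv_\<zeta>: "fls_deriv \<zeta> = 0"
proof (rule fls_eqI)
  fix k :: int
  show "fls_deriv \<zeta> $$ k = 0 $$ k"
  proof (cases "of_int (k + 1) = (0 :: 'k)")
    case True
    then show ?thesis by (simp del: of_int_add)
  next
    case False
    then have "k + 1 \<noteq> 0" by (metis of_int_0)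
    with False show ?thesis by (simp add: \<zeta>_def \<chi>_def field_simps del: of_int_add)
  qed
qed

lemma ord_\<zeta>: "ord_ge N \<zeta>"
  unfolding \<zeta>_def by (intro ord_ge_diff ord_\<eta> ord_ge_mono[OF ord_\<chi>]) simp

lemma \<zeta>_leading: "\<zeta> $$ N \<noteq> 0"
  using \<eta>_leading ord_ge_nth[OF ord_\<chi>, of N] \<mu>_pos by (simp add: \<zeta>_def)

lemma \<zeta>_nz: "\<zeta> \<noteq> 0"
  using \<zeta>_leading by auto

lemma subdegree_\<zeta>: "fls_subdegree \<zeta> = N"
  by (rule fls_subdegree_eqI) (use \<zeta>_leading ord_\<zeta> in \<open>auto simp: ord_ge_def\<close>)

definition \<omega> :: "'k fls" where "\<omega> = inverse \<zeta>"

lemma \<zeta>_\<omega>: "\<zeta> * \<omega> = 1"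
  by (simp add: \<omega>_def \<zeta>_nz)

lemma subdegree_\<omega>: "fls_subdegree \<omega> = - N" and \<omega>_nz: "\<omega> \<noteq> 0"
  by (simp_all add: \<omega>_def subdegree_\<zeta> \<zeta>_nz)

lemma ord_\<omega>: "ord_ge (- N) \<omega>"
  by (simp add: ord_ge_iff_subdegree subdegree_\<omega>)

lemma deriv_\<omega>: "fls_deriv \<omega> = 0"
proof -
  have "fls_deriv (\<zeta> * \<omega>) = 0" by (simp add: \<zeta>_\<omega>)
  then show ?thesis by (simp add: deriv_\<zeta> \<zeta>_nz)
qed

text \<open>
  Since \<open>\<omega>' = 0\<close>, the action on \<open>\<omega>\<close> is pure Taylor error.  The resulting gain of \<open>2 q1\<close>, rather than
  \<open>q1\<close>, makes division by \<open>\<zeta>\<close> harmless.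
\<close>
lemma ord_comp_diff_\<omega>: "ord_ge (- N + 2 * int q1) (comp_diff g \<omega>)"
  using G.ord_ge_remainder[OF ord_\<omega>] by (simp add: G.\<Delta>_eq deriv_\<omega>)

definition y1 :: "'k fls" where "y1 = y * \<omega>"

lemma comp_diff_y1: "comp_diff g y1 - 1 = \<chi> * \<omega> + (y + \<eta>) * comp_diff g \<omega>"
proof -
  have "\<eta> * \<omega> = 1 + \<chi> * \<omega>"
    using \<zeta>_\<omega> by (simp add: \<zeta>_def algebra_simps)
  then show ?thesis
    by (simp add: y1_def G.\<Delta>_mult \<eta>_def[symmetric] algebra_simps)
qed

lemma ord_error: "ord_ge (int q1) ((y + \<eta>) * comp_diff g \<omega>)"
proof -
  have "ord_ge (- int q) (y + \<eta>)"
    by (intro ord_ge_add ord_y ord_ge_mono[OF ord_\<eta>]) (use N_nonneg in simp)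
  from ord_ge_mult[OF this ord_comp_diff_\<omega>] show ?thesis
    by (rule ord_ge_mono) (simp add: N_def)
qed

text \<open>
  By \<open>comp_diff_y1\<close> the new error is \<open>\<chi> / \<zeta>\<close> up to order \<open>q1\<close>, and \<open>\<chi> / \<zeta>\<close> has order at least \<open>\<mu>\<close>.
\<close>
lemma approx_fatou_step: "approx_fatou g q1 \<mu> y1"
proof -
  have "ord_ge (- int q1) y1"
    using ord_ge_mult[OF ord_y ord_\<omega>] by (simp add: y1_def N_def)
  moreover have "ord_ge (int \<mu>) (\<chi> * \<omega>)"
    using ord_ge_mult[OF ord_\<chi> ord_\<omega>] by simp
  moreover have "ord_ge (int \<mu>) ((y + \<eta>) * comp_diff g \<omega>)"
    by (rule ord_ge_mono[OF ord_error]) (use \<mu>_le q1_ge_q in simp)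
  ultimately show ?thesis
    by (simp add: approx_fatou_def comp_diff_y1 ord_ge_add)
qed

text \<open>
  Exactness is inherited because every inequality in the chain leading to \<open>ord_\<chi>\<close> is sharp: \<open>\<mu>\<close> is
  prime to \<open>p\<close>, so \<open>(\<sigma>\<^sup>p - 1) \<epsilon>\<close> has exact order \<open>\<mu> + q1\<close>; as \<open>\<mu> < q\<close>, the Taylor error of \<open>\<eta>\<close>
  lies strictly above this; and \<open>N + \<mu>\<close> is prime to \<open>p\<close>, so integration loses nothing.
\<close>
lemma exact_step:
  assumes less: "\<mu> < q" and cong: "of_nat \<mu> = (of_nat q :: 'k)"
    and nz: "\<epsilon> $$ int \<mu> \<noteq> 0"
  shows "q1 = p * q + \<mu>" and "(comp_diff g y1 - 1) $$ int \<mu> \<noteq> 0"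
proof -
  have "N \<le> int \<mu> + int ((p - 1) * q)"
    using ord_ge_nth[OF ord_\<eta>] nth_\<eta>_nz[OF cong nz] by force
  moreover have "(p - 1) * q + q = p * q"
    using p_gt_1 by (cases p) simp_all
  ultimately show "q1 = p * q + \<mu>"
    using q1_ge unfolding N_def by linarith
  have \<mu>_nz: "of_nat \<mu> \<noteq> (0 :: 'k)"
    using q_coprime unfolding cong of_nat_eq_0_iff_char_dvd CHAR_p .
  have "\<Delta> \<eta> $$ (int \<mu> + int q1) = of_int (int \<mu>) * G.v0 * \<epsilon> $$ int \<mu>"
    unfolding \<Delta>_\<eta> by (rule G.nth_\<Delta>) (rule ord_\<epsilon>)
  moreover have "remainder \<eta> $$ (int \<mu> + int q1) = 0"
    by (rule ord_ge_nth[OF ord_ge_remainder[OF ord_\<eta>]]) (use less in \<open>simp add: N_def\<close>)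
  ultimately have "(v * fls_deriv \<eta>) $$ (int \<mu> + int q1) \<noteq> 0"
    using \<mu>_nz G.v0_nz nz by (simp add: \<Delta>_eq)
  moreover have "(v * fls_deriv \<eta>) $$ (int \<mu> + int q1) = v0 * fls_deriv \<eta> $$ (N + int \<mu> - 1)"
    using nth_mult_ord_ge[OF ord_ge_v ord_deriv_\<eta>] by (simp add: N_def algebra_simps)
  ultimately have "fls_deriv \<eta> $$ (N + int \<mu> - 1) \<noteq> 0" by auto
  moreover have "of_int (N + int \<mu>) \<noteq> (0 :: 'k)"
    using \<mu>_nz by (simp add: of_int_N)
  moreover have "N + int \<mu> \<noteq> 0"
    using N_nonneg \<mu>_pos by simp
  ultimately have "\<chi> $$ (N + int \<mu>) \<noteq> 0"
    by (simp add: \<chi>_def del: fls_deriv_nth of_int_add)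
  moreover have "\<omega> $$ (- N) \<noteq> 0"
    using nth_fls_subdegree_nonzero[OF \<omega>_nz] by (simp add: subdegree_\<omega>)
  ultimately have "(\<chi> * \<omega>) $$ int \<mu> \<noteq> 0"
    using nth_mult_ord_ge[OF ord_\<chi> ord_\<omega>] by simp
  moreover have "((y + \<eta>) * comp_diff g \<omega>) $$ int \<mu> = 0"
    by (rule ord_ge_nth[OF ord_error]) (use less q1_ge_q in simp)
  ultimately show "(comp_diff g y1 - 1) $$ int \<mu> \<noteq> 0"
    by (simp add: comp_diff_y1)
qed

end


section \<open>Ramification numbers from a Fatou coordinate\<close>

lemma approx_fatou_iterate_step:
  fixes f :: "'k::field fps"
  assumes "prime p" "CHAR('k) = p" "tangent_series f q" "\<not> p dvd q" "0 < \<mu>" "\<mu> \<le> q"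
    "approx_fatou f q \<mu> y" "fps_iterate f p \<noteq> fps_X"
  shows "\<exists>q' y'. p * q + \<mu> \<le> q' \<and> tangent_series (fps_iterate f p) q' \<and> \<not> p dvd q'
    \<and> approx_fatou (fps_iterate f p) q' \<mu> y'"
proof -
  interpret wild_fatou_step f q p \<mu> y
    using assms by (simp add: wild_fatou_step_def wild_fatou_def wild_fatou_axioms_def
        wild_fatou_step_axioms_def)
  show ?thesis
    using q1_ge q1_coprime approx_fatou_step G.tangent_series_axioms by blast
qed

lemma exact_fatou_iterate_step:
  fixes f :: "'k::field fps"
  assumes "prime p" "CHAR('k) = p" "tangent_series f q" "\<not> p dvd q" "0 < \<mu>" "\<mu> < q"
    and cong: "of_nat \<mu> = (of_nat q :: 'k)"
    and "approx_fatou f q \<mu> y" and nz: "(comp_diff f y - 1) $$ int \<mu> \<noteq> 0"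
  shows "tangent_series (fps_iterate f p) (p * q + \<mu>)"
    "\<exists>y'. approx_fatou (fps_iterate f p) (p * q + \<mu>) \<mu> y'
       \<and> (comp_diff (fps_iterate f p) y' - 1) $$ int \<mu> \<noteq> 0"
proof -
  interpret wild_fatou f q p \<mu> y
    using assms by (simp add: wild_fatou_def wild_fatou_axioms_def)
  have nz': "\<epsilon> $$ int \<mu> \<noteq> 0" using nz by (simp add: \<epsilon>_def)
  interpret wild_fatou_step f q p \<mu> y
  proof
    show "g \<noteq> fps_X"
      using nth_\<eta>_nz[OF cong nz'] by (auto simp: \<eta>_def comp_diff_fps_X)
  qed
  note e = exact_step[OF \<open>\<mu> < q\<close> cong nz']
  show "tangent_series g (p * q + \<mu>)"
    using G.tangent_series_axioms by (simp add: e(1))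
  show "\<exists>y'. approx_fatou g (p * q + \<mu>) \<mu> y' \<and> (comp_diff g y' - 1) $$ int \<mu> \<noteq> 0"
    using approx_fatou_step e by auto
qed

definition expected_ramification :: "nat \<Rightarrow> nat \<Rightarrow> nat \<Rightarrow> nat \<Rightarrow> nat" where
  "expected_ramification p q \<mu> n = \<mu> * (\<Sum>k<n. p ^ k) + q * p ^ n"

lemma expected_ramification_0: "expected_ramification p q \<mu> 0 = q"
  by (simp add: expected_ramification_def)

lemma expected_ramification_Suc:
  "expected_ramification p q \<mu> (Suc n) = p * expected_ramification p q \<mu> n + \<mu>"
proof -
  have "(\<Sum>k<Suc n. p ^ k) = 1 + p * (\<Sum>k<n. p ^ k)"
    by (subst sum.lessThan_Suc_shift) (simp add: sum_distrib_left)
  then show ?thesis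
    unfolding expected_ramification_def by (simp add: algebra_simps)
qed

text \<open>
  Some iterate may be the identity, whose ramification number is infinite; from then on there is
  nothing to bound.
\<close>
lemma ramification_lower_bound:
  fixes f :: "'k::field fps"
  assumes p: "prime p" "CHAR('k) = p" and f: "tangent_series f q" "\<not> p dvd q"
    and \<mu>: "0 < \<mu>" "\<mu> \<le> q" and y: "approx_fatou f q \<mu> y"
  shows "fps_iterate f (p ^ n) = fps_X \<or>
    (\<exists>q' y'. expected_ramification p q \<mu> n \<le> q' \<and> \<mu> \<le> q' \<and> tangent_series (fps_iterate f (p ^ n)) q'
       \<and> \<not> p dvd q' \<and> approx_fatou (fps_iterate f (p ^ n)) q' \<mu> y')"
proof (induction n)
  case 0
  have "fps_iterate f 1 = f" by (simp add: fps_iterate_def)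
  then show ?case using f \<mu> y by (auto simp: expected_ramification_0)
next
  case (Suc n)
  have f0: "f $ 0 = 0" using f(1) by (simp add: tangent_series_def)
  let ?F = "fps_iterate f (p ^ n)"
  show ?case
  proof (cases "fps_iterate ?F p = fps_X")
    case True
    then show ?thesis by (simp only: fps_iterate_power_Suc[OF f0]) simp
  next
    case False
    then have "?F \<noteq> fps_X" by (auto simp: fps_iterate_fps_X)
    with Suc obtain q' y' where q': "expected_ramification p q \<mu> n \<le> q'" "\<mu> \<le> q'"
      "tangent_series ?F q'" "\<not> p dvd q'" "approx_fatou ?F q' \<mu> y'"
      by blast
    from approx_fatou_iterate_step[OF p q'(3,4) \<mu>(1) q'(2,5) False]
    obtain q'' y'' where q'': "p * q' + \<mu> \<le> q''" "tangent_series (fps_iterate ?F p) q''"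
      "\<not> p dvd q''" "approx_fatou (fps_iterate ?F p) q'' \<mu> y''"
      by blast
    have "p * expected_ramification p q \<mu> n \<le> p * q'"
      using q'(1) by (rule mult_left_mono) simp
    then have "expected_ramification p q \<mu> (Suc n) \<le> q''" "\<mu> \<le> q''"
      unfolding expected_ramification_Suc using q''(1) by linarith+
    then show ?thesis
      unfolding fps_iterate_power_Suc[OF f0] using q''(2-) by blast
  qed
qed

text \<open>
  Exactness also shows that no iterate is trivial: in \<open>exact_fatou_iterate_step\<close> the series \<open>\<eta>\<close> does
  not vanish.
\<close>
lemma ramification_exact:
  fixes f :: "'k::field fps"
  assumes p: "prime p" "CHAR('k) = p" and f: "tangent_series f q" "\<not> p dvd q"
    and \<mu>: "0 < \<mu>" "\<mu> < q" and cong: "of_nat \<mu> = (of_nat q :: 'k)"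
    and y: "approx_fatou f q \<mu> y" "(comp_diff f y - 1) $$ int \<mu> \<noteq> 0"
  shows "tangent_series (fps_iterate f (p ^ n)) (expected_ramification p q \<mu> n) \<and>
    (\<exists>y'. approx_fatou (fps_iterate f (p ^ n)) (expected_ramification p q \<mu> n) \<mu> y'
       \<and> (comp_diff (fps_iterate f (p ^ n)) y' - 1) $$ int \<mu> \<noteq> 0)"
proof (induction n)
  case 0
  have "fps_iterate f 1 = f" by (simp add: fps_iterate_def)
  then show ?case using f y by (auto simp: expected_ramification_0)
next
  case (Suc n)
  have f0: "f $ 0 = 0" using f(1) by (simp add: tangent_series_def)
  let ?F = "fps_iterate f (p ^ n)" and ?Q = "expected_ramification p q \<mu> n"
  from Suc obtain y' where y': "tangent_series ?F ?Q" "approx_fatou ?F ?Q \<mu> y'"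
    "(comp_diff ?F y' - 1) $$ int \<mu> \<noteq> 0"
    by blast
  have "of_nat p = (0 :: 'k)" using of_nat_CHAR[where 'a = 'k] by (simp add: p(2))
  then have Q_cong: "of_nat \<mu> = (of_nat ?Q :: 'k)"
    by (cases n) (simp_all add: expected_ramification_0 expected_ramification_Suc cong)
  have "of_nat q \<noteq> (0 :: 'k)"
    using f(2) unfolding of_nat_eq_0_iff_char_dvd p(2) .
  then have "\<not> p dvd ?Q"
    using cong Q_cong by (metis of_nat_eq_0_iff_char_dvd p(2))
  moreover have "\<mu> < ?Q"
  proof -
    have "q * 1 \<le> q * p ^ n"
      by (rule mult_left_mono) (use prime_gt_0_nat[OF p(1)] in simp_all)
    then show ?thesis
      using \<mu>(2) unfolding expected_ramification_def by linarith
  qed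
  ultimately show ?case
    using exact_fatou_iterate_step[OF p y'(1) _ \<mu>(1) _ Q_cong y'(2,3)]
    unfolding fps_iterate_power_Suc[OF f0] expected_ramification_Suc by blast
qed

section \<open>The first Fatou coordinate and the invariants\<close>

context tangent_series
begin

lemma fixpoint_mult_eq: "fixpoint_mult f = enat (q + 1)"
proof -
  have "f \<noteq> fps_X" using subdegree_diff by auto
  then show ?thesis using subdegree_diff unfolding fixpoint_mult_def by simp
qed

text \<open>
  The numbers \<open>\<iota>\<^sub>i\<close> are, up to sign, coefficients of \<open>1/v\<close> at exponents congruent to \<open>-1\<close> modulo \<open>p\<close>.
\<close>
lemma iota_eq:
  assumes "ell_seq p l i \<le> q"
  shows "iota p q l f i = - (inverse v $$ (int (ell_seq p l i) - int q - 1))"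
proof -
  let ?n = "q - ell_seq p l i"
  have "fls_X - fps_to_fls f = - v" by (simp add: v_def)
  then have "iota p q l f i = (fls_X ^ ?n * inverse (- v)) $$ - 1"
    by (simp add: iota_def divide_inverse)
  also have "\<dots> = - (inverse v $$ (- 1 - int ?n))"
    by (simp add: fls_X_power_times_conv_shift inverse_minus_eq)
  also have "- 1 - int ?n = int (ell_seq p l i) - int q - 1"
    using assms by simp
  finally show ?thesis .
qed

text \<open>
  With \<open>y\<close> the formal primitive of \<open>1/v\<close>, the derivation \<open>v d/dz\<close> maps \<open>y\<close> to \<open>1 - v R\<close>, where \<open>R\<close>
  collects the terms of \<open>1/v\<close> with exponents congruent to \<open>-1\<close> modulo \<open>p\<close>.  The Taylor error has order at
  least \<open>-q + 2q = q\<close>; hence below \<open>q\<close> the error of the Fatou coordinate is read off from \<open>v R\<close>.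
\<close>
lemma initial_fatou:
  assumes \<mu>: "\<mu> \<le> q"
    and vanish: "\<And>k. k < int \<mu> \<Longrightarrow> of_int k = (of_nat q :: 'k) \<Longrightarrow> inverse v $$ (k - int q - 1) = 0"
  defines "y \<equiv> fls_integral (inverse v)"
  shows "approx_fatou f q \<mu> y"
    and "\<mu> < q \<Longrightarrow> of_nat \<mu> = (of_nat q :: 'k) \<Longrightarrow>
      (\<Delta> y - 1) $$ int \<mu> = - v0 * inverse v $$ (int \<mu> - int q - 1)"
proof -
  define R where "R = inverse v - fls_deriv y"
  have R_nth: "R $$ k = (if of_int (k + 1) = (0 :: 'k) then inverse v $$ k else 0)" for k
  proof (cases "of_int (k + 1) = (0 :: 'k)")
    case True
    then show ?thesis by (simp add: R_def del: of_int_add)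
  next
    case False
    then have "k + 1 \<noteq> 0" by (metis of_int_0)
    with False show ?thesis by (simp add: R_def y_def field_simps del: of_int_add)
  qed
  have ord_R: "ord_ge (int \<mu> - int q - 1) R"
    unfolding ord_ge_def
  proof (intro allI impI)
    fix k assume k: "k < int \<mu> - int q - 1"
    show "R $$ k = 0"
    proof (cases "of_int (k + 1) = (0 :: 'k)")
      case True
      have "of_int (k + int q + 1) = (of_int (k + 1) + of_nat q :: 'k)" by simp
      also have "\<dots> = of_nat q" using True by (simp del: of_int_add)
      finally have "inverse v $$ (k + int q + 1 - int q - 1) = 0"
        using k by (intro vanish) auto
      then show ?thesis by (simp add: R_nth)
    qed (simp add: R_nth)
  qed
  have "ord_ge (- int q - 1) (inverse v)"
    by (simp add: ord_ge_iff_subdegree subdegree_v)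
  from ord_ge_integral[OF this] have ord_y: "ord_ge (- int q) y"
    by (simp add: y_def)
  have rem: "ord_ge (int q) (remainder y)"
    using ord_ge_remainder[OF ord_y] by simp
  have eq: "\<Delta> y - 1 = remainder y - v * R"
    using v_nz by (simp add: \<Delta>_eq R_def algebra_simps)
  have vR: "ord_ge (int \<mu>) (v * R)"
    using ord_ge_mult[OF ord_ge_v ord_R] by simp
  show "approx_fatou f q \<mu> y"
    unfolding approx_fatou_def eq
    by (intro conjI ord_y ord_ge_diff vR ord_ge_mono[OF rem]) (use \<mu> in simp)
  show "(\<Delta> y - 1) $$ int \<mu> = - v0 * inverse v $$ (int \<mu> - int q - 1)"
    if "\<mu> < q" "of_nat \<mu> = (of_nat q :: 'k)"
  proof -
    have "remainder y $$ int \<mu> = 0"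
      by (rule ord_ge_nth[OF rem]) (use that in simp)
    moreover have "(v * R) $$ int \<mu> = v0 * R $$ (int \<mu> - int q - 1)"
      using nth_mult_ord_ge[OF ord_ge_v ord_R] by simp
    moreover have "R $$ (int \<mu> - int q - 1) = inverse v $$ (int \<mu> - int q - 1)"
      using that(2) by (simp add: R_nth)
    ultimately show ?thesis by (simp add: eq)
  qed
qed

end

section \<open>The ramification numbers and the first non-vanishing invariant\<close>

lemma tangent_lower_ramification:
  assumes "tangent_series (fps_iterate f (p ^ n)) Q"
  shows "lower_ramification p f n = enat Q"
  using tangent_series.fixpoint_mult_eq[OF assms]
  by (simp add: lower_ramification_def one_enat_def)

theorem theorem2:
  fixes p q l j n :: nat
    and f :: "'k::field fps"
  assumes "prime p"
    and "CHAR('k) = p"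
    and "q \<ge> p + 1"
    and "\<not> p dvd q"
    and "l = (LEAST m. (of_nat m :: 'k) = of_nat q)"
    and "1 \<le> j"
    and "int j \<le> \<lceil>real q / real p\<rceil> - 1"
    and "fps_nth f 0 = 0"
    and "fixpoint_mult f = enat (q + 1)"
    and "n \<ge> 1"
  shows "lower_ramification p f n = enat (ell_seq p l j * (\<Sum>k<n. p ^ k) + q * p ^ n)
    \<longleftrightarrow> iota p q l f j \<noteq> 0 \<and>
       (\<forall>i::nat. 1 \<le> i \<and> int i \<le> \<lceil>real q / real p\<rceil> \<and> iota p q l f i \<noteq> 0 \<longrightarrow> j \<le> i)"
proof -
  note p = assms(1,2)
  have p_pos: "0 < p" using p(1) prime_gt_0_nat by blast
  have "subdegree (f - fps_X) = q + 1"
    using assms(9) by (simp add: fixpoint_mult_def split: if_splits)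
  then interpret tangent_series f q
    using assms(3,8) by unfold_locales auto
  have of_p: "of_nat p = (0 :: 'k)" using of_nat_CHAR[where 'a = 'k] by (simp add: p(2))
  have dvd_iff: "of_nat m = (0 :: 'k) \<longleftrightarrow> p dvd m" for m
    unfolding of_nat_eq_0_iff_char_dvd p(2) ..
  have of_l: "of_nat l = (of_nat q :: 'k)"
    unfolding assms(5) by (rule LeastI) (rule refl)
  have l_le: "l \<le> m" if "of_nat m = (of_nat q :: 'k)" for m
    unfolding assms(5) by (rule Least_le) (rule that)
  have "of_nat (q mod p) = (of_nat (q mod p + p * (q div p)) :: 'k)"
    by (simp only: of_nat_add of_nat_mult of_p) simp
  then have l_less: "l < p"
    using le_less_trans[OF l_le mod_less_divisor[OF p_pos]] by simp
  have l_pos: "0 < l"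
    using assms(4) of_l dvd_iff[of q] by (cases "l = 0") auto
  have index_iff: "int i \<le> \<lceil>real q / real p\<rceil> - 1 \<longleftrightarrow> i * p < q" for i :: nat
  proof -
    have "int i \<le> \<lceil>real q / real p\<rceil> - 1 \<longleftrightarrow> real i < real q / real p"
      using less_ceiling_iff[of "int i" "real q / real p"] by auto
    also have "\<dots> \<longleftrightarrow> real (i * p) < real q"
      using p_pos by (simp add: pos_less_divide_eq)
    finally show ?thesis by (simp only: of_nat_less_iff)
  qed
  have of_ell: "of_nat (ell_seq p l i) = (of_nat q :: 'k)" for i
    by (simp add: ell_seq_def of_l of_p)
  have ell_pos: "0 < ell_seq p l i" for i
    using l_pos by (simp add: ell_seq_def)
  have ell_less: "ell_seq p l i < q" if "1 \<le> i" "i * p < q" for i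
  proof -
    have "(i - 1) * p + p = i * p" using that(1) by (cases i) simp_all
    then show ?thesis using that(2) l_less by (simp add: ell_seq_def)
  qed
  have ell_strict_mono: "ell_seq p l i < ell_seq p l i'" if "1 \<le> i" "i < i'" for i i'
    using that p_pos by (simp add: ell_seq_def)
  (* An exponent below q in the residue class of q lies at least p below q, whence i * p < q. *)
  have ell_surj: "\<exists>i\<ge>1. ell_seq p l i = c \<and> i * p < q"
    if c: "of_nat c = (of_nat q :: 'k)" "c < q" for c
  proof -
    have "of_nat (c - l) = (0 :: 'k)" "of_nat (q - c) = (0 :: 'k)"
      using c of_l l_le[OF c(1)] by (simp_all add: of_nat_diff)
    then have dvd: "p dvd c - l" "p dvd q - c" by (simp_all add: dvd_iff)
    then obtain r where r: "c - l = p * r" by (elim dvdE)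
    have "p \<le> q - c" using dvd(2) c(2) by (intro dvd_imp_le) auto
    then have "ell_seq p l (r + 1) = c" "(r + 1) * p < q"
      using r l_le[OF c(1)] l_pos c(2) by (auto simp: ell_seq_def algebra_simps)
    then show ?thesis by (intro exI[of _ "r + 1"]) simp
  qed
  have fatou: "approx_fatou f q \<mu> (fls_integral (inverse v))"
    "\<mu> < q \<Longrightarrow> of_nat \<mu> = (of_nat q :: 'k) \<Longrightarrow>
      (\<Delta> (fls_integral (inverse v)) - 1) $$ int \<mu> = - v0 * inverse v $$ (int \<mu> - int q - 1)"
    if "\<mu> \<le> q" and small: "\<And>i. 1 \<le> i \<Longrightarrow> i * p < q \<Longrightarrow> ell_seq p l i < \<mu> \<Longrightarrow> iota p q l f i = 0"
    for \<mu>
  proof -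
    have "inverse v $$ (k - int q - 1) = 0"
      if k: "k < int \<mu>" "of_int k = (of_nat q :: 'k)" for k
    proof (cases "0 \<le> k")
      case False
      then show ?thesis by (intro fls_eq0_below_subdegree) (simp add: subdegree_v)
    next
      case True
      then obtain c where c: "k = int c" by (metis nonneg_int_cases)
      with k \<open>\<mu> \<le> q\<close> obtain i where i: "1 \<le> i" "ell_seq p l i = c" "i * p < q"
        using ell_surj[of c] by auto
      with small[of i] k c have "iota p q l f i = 0" by simp
      with iota_eq[of p l i] ell_less[of i] i c show ?thesis by simp
    qed
    from initial_fatou[OF \<open>\<mu> \<le> q\<close> this] show
      "approx_fatou f q \<mu> (fls_integral (inverse v))"
      "\<mu> < q \<Longrightarrow> of_nat \<mu> = (of_nat q :: 'k) \<Longrightarrow>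
        (\<Delta> (fls_integral (inverse v)) - 1) $$ int \<mu> = - v0 * inverse v $$ (int \<mu> - int q - 1)"
      by blast+
  qed
  have sum_pos: "0 < (\<Sum>k<n. p ^ k)"
    using \<open>n \<ge> 1\<close> p_pos by (intro sum_pos) (auto simp: lessThan_empty_iff)
  have formula_inj: "a * (\<Sum>k<n. p ^ k) + c = b * (\<Sum>k<n. p ^ k) + c \<longleftrightarrow> a = b" for a b c :: nat
    unfolding add_right_cancel mult_cancel2 using less_imp_neq[OF sum_pos] by metis
  have j: "1 \<le> j" "j * p < q" using assms(6,7) index_iff[of j] by blast+
  let ?P = "\<lambda>i. 1 \<le> i \<and> i * p < q \<and> iota p q l f i \<noteq> 0"
  show ?thesis
  proof (cases "\<exists>i. ?P i")
    case True
    define m where "m = (LEAST i. ?P i)"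
    have m: "?P m" unfolding m_def using True by (rule LeastI_ex)
    have m_le: "m \<le> i" if "?P i" for i unfolding m_def using that by (rule Least_le)
    let ?\<mu> = "ell_seq p l m"
    have \<mu>_less: "?\<mu> < q" using m by (simp add: ell_less)
    have small: "iota p q l f i = 0" if "1 \<le> i" "i * p < q" "ell_seq p l i < ?\<mu>" for i
    proof (rule ccontr)
      assume "iota p q l f i \<noteq> 0"
      then have "m \<le> i" using that m_le by blast
      then have "?\<mu> \<le> ell_seq p l i"
        using ell_strict_mono[of m i] m by (cases "m = i") auto
      with that show False by simp
    qed
    have "inverse v $$ (int ?\<mu> - int q - 1) \<noteq> 0"
      using m iota_eq[of p l m] \<mu>_less by simp
    then have "(\<Delta> (fls_integral (inverse v)) - 1) $$ int ?\<mu> \<noteq> 0"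
      using fatou(2)[of ?\<mu>, OF _ small] \<mu>_less of_ell[of m] v0_nz by simp
    from ramification_exact[OF p tangent_series_axioms assms(4) ell_pos \<mu>_less of_ell
        fatou(1)[OF less_imp_le[OF \<mu>_less] small] this]
    have "lower_ramification p f n = enat (?\<mu> * (\<Sum>k<n. p ^ k) + q * p ^ n)"
      unfolding expected_ramification_def by (intro tangent_lower_ramification) blast
    then have "?thesis \<longleftrightarrow> (ell_seq p l m = ell_seq p l j \<longleftrightarrow> iota p q l f j \<noteq> 0 \<and>
       (\<forall>i::nat. 1 \<le> i \<and> int i \<le> \<lceil>real q / real p\<rceil> \<and> iota p q l f i \<noteq> 0 \<longrightarrow> j \<le> i))"
      by (simp only: enat.inject formula_inj)
    also have "ell_seq p l m = ell_seq p l j \<longleftrightarrow> m = j"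
      using ell_strict_mono[of m j] ell_strict_mono[of j m] m j by (cases m j rule: linorder_cases) auto
    also have "(m = j \<longleftrightarrow> iota p q l f j \<noteq> 0 \<and>
       (\<forall>i::nat. 1 \<le> i \<and> int i \<le> \<lceil>real q / real p\<rceil> \<and> iota p q l f i \<noteq> 0 \<longrightarrow> j \<le> i))"
    proof
      assume "m = j"
      have "j \<le> i" if "1 \<le> i" "iota p q l f i \<noteq> 0" for i
      proof (rule ccontr)
        assume "\<not> j \<le> i"
        then have "i * p \<le> j * p" by simp
        with j that have "?P i" by linarith
        with m_le \<open>m = j\<close> \<open>\<not> j \<le> i\<close> show False by blast
      qed
      with m \<open>m = j\<close> show "iota p q l f j \<noteq> 0 \<and>
         (\<forall>i::nat. 1 \<le> i \<and> int i \<le> \<lceil>real q / real p\<rceil> \<and> iota p q l f i \<noteq> 0 \<longrightarrow> j \<le> i)"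
        by blast
    next
      assume rhs: "iota p q l f j \<noteq> 0 \<and>
         (\<forall>i::nat. 1 \<le> i \<and> int i \<le> \<lceil>real q / real p\<rceil> \<and> iota p q l f i \<noteq> 0 \<longrightarrow> j \<le> i)"
      then have "m \<le> j" using j m_le by blast
      moreover have "int m \<le> \<lceil>real q / real p\<rceil>"
        using m index_iff[of m] by auto
      then have "j \<le> m" using m rhs by blast
      ultimately show "m = j" by simp
    qed
    finally show ?thesis by blast
  next
    case False
    (* All obstructions below order q vanish, so mu = q is available. *)
    let ?e = "expected_ramification p q q n"
    have "approx_fatou f q q (fls_integral (inverse v))"
      using False by (intro fatou(1)) auto
    from ramification_lower_bound[OF p tangent_series_axioms assms(4) q_pos order_refl this, of n]
    consider "fps_iterate f (p ^ n) = fps_X"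
      | Q where "?e \<le> Q" "tangent_series (fps_iterate f (p ^ n)) Q" by blast
    then have "lower_ramification p f n \<ge> enat ?e"
    proof cases
      case 1
      then show ?thesis by (simp add: lower_ramification_def fixpoint_mult_def)
    next
      case 2
      then show ?thesis by (simp add: tangent_lower_ramification)
    qed
    moreover have "ell_seq p l j * (\<Sum>k<n. p ^ k) + q * p ^ n < ?e"
      using ell_less[OF j] sum_pos by (simp add: expected_ramification_def)
    ultimately have "lower_ramification p f n \<noteq> enat (ell_seq p l j * (\<Sum>k<n. p ^ k) + q * p ^ n)"
      by auto
    moreover have "iota p q l f j = 0"
      using False j by blast
    ultimately show ?thesis by blast
  qed
qed

end
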